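(* For all integers $m\ge 9$ with $m\equiv 1\pmod 4$ and $n\ge 7$ with $n\equiv 3\pmod 4$, there exists an integer Heffter array $H(m,n)$.
   Context: An integer Heffter array $H(m,n)$ is an $m\times n$ array with entries from $\{-mn,\dots,mn\}$ such that every row and every column sums to $0$ over the integers and no element from any pair $\{x,-x\}$ appears twice, so the multiset of absolute values of the entries is exactly $\{1,\dots,mn\}$. *)

theory Defs
  imports Main "HOL-Library.Multiset"
begin

text \<open>
  An \<open>m \<times> n\<close> array of integers is a function of a row index \<open>i < m\<close> and a column
  index \<open>j < n\<close>; its values outside this range play no role.
  The entry \<open>0\<close> is excluded: otherwise the pair \<open>{0, -0}\<close> could be used,
  and the absolute values would not have to be \<open>1, \<dots>, m n\<close>.
  Injectivity of the absolute value on the cells says that from each pair \<open>{x, -x}\<close>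
  at most one element occurs, and at most once.
\<close>

definition integer_heffter_array :: "nat \<Rightarrow> nat \<Rightarrow> (nat \<Rightarrow> nat \<Rightarrow> int) \<Rightarrow> bool" where
  "integer_heffter_array m n A \<longleftrightarrow>
     (\<forall>i<m. \<forall>j<n. A i j \<in> {- int (m * n)..int (m * n)} - {0}) \<and>
     (\<forall>i<m. (\<Sum>j<n. A i j) = 0) \<and>
     (\<forall>j<n. (\<Sum>i<m. A i j) = 0) \<and>
     inj_on (\<lambda>(i, j). \<bar>A i j\<bar>) ({..<m} \<times> {..<n})"

lemma integer_heffter_array_abs_image:
  assumes "integer_heffter_array m n A"
  shows "(\<lambda>(i, j). \<bar>A i j\<bar>) ` ({..<m} \<times> {..<n}) = {1..int (m * n)}"
proof (rule card_subset_eq)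
  have "1 \<le> \<bar>A i j\<bar> \<and> \<bar>A i j\<bar> \<le> int (m * n)" if "i < m" "j < n" for i j
  proof -
    have "A i j \<in> {- int (m * n)..int (m * n)} - {0}"
      using assms that unfolding integer_heffter_array_def by blast
    then show ?thesis by (auto simp del: of_nat_mult)
  qed
  then show "(\<lambda>(i, j). \<bar>A i j\<bar>) ` ({..<m} \<times> {..<n}) \<subseteq> {1..int (m * n)}"
    by (auto simp del: of_nat_mult)
  show "card ((\<lambda>(i, j). \<bar>A i j\<bar>) ` ({..<m} \<times> {..<n})) = card {1..int (m * n)}"
    using assms by (simp add: integer_heffter_array_def card_image card_cartesian_product nat_mult_distrib)
qed simp

lemma integer_heffter_array_abs_mset:
  assumes "integer_heffter_array m n A"
  shows "image_mset (\<lambda>(i, j). \<bar>A i j\<bar>) (mset_set ({..<m} \<times> {..<n})) = mset_set {1..int (m * n)}"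
proof -
  have "inj_on (\<lambda>(i, j). \<bar>A i j\<bar>) ({..<m} \<times> {..<n})"
    using assms by (simp add: integer_heffter_array_def)
  from image_mset_mset_set[OF this] show ?thesis
    using integer_heffter_array_abs_image[OF assms] by simp
qed

end

theory Submission
  imports Defs
begin

text \<open>
  Write \<open>m = 4a + 1\<close> and \<open>n = 4k + 3\<close>. Only the zero sums and the surjectivity of the absolute values
  onto \<open>{1, \<dots>, mn}\<close> need to be arranged: injectivity then follows by counting. Arrays with zero row
  and column sums can be glued together, so the array is tiled by small blocks with zero sums.

  The first three columns consist of rows \<open>(x, y, - (x + y))\<close>, rotated and negated, in two classes
  \<open>(s + 2t, r - t)\<close> and \<open>(s + 2t + 1, q - t)\<close>. For a suitable \<open>q\<close> the three kinds of entries fill three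
  intervals of length \<open>4a + 1\<close>, and \<open>s\<close>, \<open>r\<close> remain free. The first five entries of the other columns are
  built in the same way from triples \<open>x, y, z\<close> with \<open>z - x - y \<in> {\<plusminus>1, \<plusminus>2}\<close> and a pair making up the
  difference. All remaining cells are tiled by \<open>4 \<times> 4\<close> arrays on four runs of four consecutive numbers,
  which may be anywhere.

  It remains to place these intervals so that all gaps between them have length divisible by 4. This
  depends on parities. If \<open>a\<close> is odd, an extra \<open>5 \<times> 4\<close> block first uses up
  \<open>1, \<dots>, 10\<close> and \<open>mn - 9, \<dots>, mn\<close>, which shifts the remaining interval by 2 modulo 4.
\<close>

section \<open>Arrays with zero row and column sums, and how they are glued\<close>

text \<open>Neither disjointness nor the size of the entries is recorded, so the notion is monotone
  in \<open>S\<close> and blocks with arbitrary integer parameters combine freely; exactness is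
  recovered at the end by counting.\<close>

definition covers :: "nat \<Rightarrow> nat \<Rightarrow> int set \<Rightarrow> bool" where
  "covers m n S \<longleftrightarrow>
     (\<exists>A :: nat \<Rightarrow> nat \<Rightarrow> int.
        (\<forall>i<m. (\<Sum>j<n. A i j) = 0) \<and> (\<forall>j<n. (\<Sum>i<m. A i j) = 0) \<and>
        (\<forall>x\<in>S. \<exists>i<m. \<exists>j<n. A i j = x \<or> A i j = - x))"

lemma covers_mono: "covers m n S \<Longrightarrow> T \<subseteq> S \<Longrightarrow> covers m n T"
  unfolding covers_def by blast

lemma covers_transpose:
  assumes "covers m n S"
  shows "covers n m S"
proof -
  obtain A where A: "\<forall>i<m. (\<Sum>j<n. A i j) = 0" "\<forall>j<n. (\<Sum>i<m. A i j) = 0"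
    "\<forall>x\<in>S. \<exists>i<m. \<exists>j<n. A i j = x \<or> A i j = - x"
    using assms unfolding covers_def by blast
  show ?thesis
    unfolding covers_def by (rule exI[of _ "\<lambda>j i. A i j"]) (use A in blast)
qed

lemma sum_lessThan_add:
  fixes f :: "nat \<Rightarrow> 'a::comm_monoid_add"
  shows "(\<Sum>i<m + k. f i) = (\<Sum>i<m. f i) + (\<Sum>i<k. f (m + i))"
  by (induction k) (simp_all add: add.assoc)

lemma covers_append_rows:
  assumes "covers m n S" "covers k n T"
  shows "covers (m + k) n (S \<union> T)"
proof -
  obtain A where A: "\<forall>i<m. (\<Sum>j<n. A i j) = 0" "\<forall>j<n. (\<Sum>i<m. A i j) = 0"
    "\<forall>x\<in>S. \<exists>i<m. \<exists>j<n. A i j = x \<or> A i j = - x"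
    using assms(1) unfolding covers_def by blast
  obtain B where B: "\<forall>i<k. (\<Sum>j<n. B i j) = 0" "\<forall>j<n. (\<Sum>i<k. B i j) = 0"
    "\<forall>x\<in>T. \<exists>i<k. \<exists>j<n. B i j = x \<or> B i j = - x"
    using assms(2) unfolding covers_def by blast
  let ?C = "\<lambda>i j. if i < m then A i j else B (i - m) j"
  have "(\<Sum>j<n. ?C i j) = 0" if "i < m + k" for i
    using A(1) B(1) that by (cases "i < m") auto
  moreover have "(\<Sum>i<m + k. ?C i j) = 0" if "j < n" for j
    using A(2) B(2) that by (simp add: sum_lessThan_add)
  moreover have "\<exists>i<m + k. \<exists>j<n. ?C i j = x \<or> ?C i j = - x" if x: "x \<in> S \<union> T" for x
  proof (cases "x \<in> S")
    case True
    then obtain i j where "i < m" "j < n" "A i j = x \<or> A i j = - x"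
      using A(3) by blast
    then show ?thesis
      by (intro exI[of _ i] exI[of _ j] conjI) auto
  next
    case False
    then obtain i j where "i < k" "j < n" "B i j = x \<or> B i j = - x"
      using B(3) x by blast
    then show ?thesis
      by (intro exI[of _ "m + i"] exI[of _ j] conjI) auto
  qed
  ultimately show ?thesis
    unfolding covers_def by (intro exI[of _ ?C]) blast
qed

lemma covers_append_cols:
  assumes "covers m n S" "covers m k T"
  shows "covers m (n + k) (S \<union> T)"
  using assms by (meson covers_append_rows covers_transpose)

lemma covers_no_cols: "covers m 0 {}"
  unfolding covers_def by simp

text \<open>Phrased over lists so that simplification can check all conditions on a literal array
  with symbolic entries.\<close>

lemma covers_lists:
  fixes L :: "int list list"
  assumes "length L = m"
    and rows: "\<forall>r\<in>set L. length r = n \<and> sum_list r = 0"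
    and cols: "\<forall>j\<in>set [0..<n]. (\<Sum>r\<leftarrow>L. r ! j) = 0"
    and S: "\<forall>x\<in>S. x \<in> set (concat L) \<or> - x \<in> set (concat L)"
  shows "covers m n S"
proof -
  let ?A = "\<lambda>i j. L ! i ! j"
  have "(\<Sum>j<n. ?A i j) = 0" if "i < m" for i
  proof -
    have "L ! i \<in> set L" using that assms(1) by simp
    with rows show ?thesis
      by (metis atLeast0LessThan sum_list_sum_nth)
  qed
  moreover have "(\<Sum>i<m. ?A i j) = 0" if "j < n" for j
    using cols that assms(1) by (simp add: sum_list_sum_nth atLeast0LessThan)
  moreover have "\<exists>i<m. \<exists>j<n. ?A i j = x \<or> ?A i j = - x" if x: "x \<in> S" for x
  proof -
    obtain r where "r \<in> set L" "x \<in> set r \<or> - x \<in> set r"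
      using S x unfolding set_concat by blast
    then show ?thesis
      using rows assms(1) by (metis in_set_conv_nth)
  qed
  ultimately show ?thesis
    unfolding covers_def by (intro exI[of _ ?A]) blast
qed

text \<open>The \<open>m * n\<close> cells have at most \<open>m * n\<close> absolute values, yet
  these include all of \<open>{1..int (m * n)}\<close>. So the image is exactly this interval, which
  bounds the entries and excludes \<open>0\<close>, and the map is injective.\<close>

lemma integer_heffter_array_of_covers:
  assumes "covers m n {1..int (m * n)}"
  shows "\<exists>A. integer_heffter_array m n A"
proof -
  obtain A where A: "\<forall>i<m. (\<Sum>j<n. A i j) = 0" "\<forall>j<n. (\<Sum>i<m. A i j) = 0"
    "\<forall>x\<in>{1..int (m * n)}. \<exists>i<m. \<exists>j<n. A i j = x \<or> A i j = - x"
    using assms unfolding covers_def by blast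
  let ?D = "{..<m} \<times> {..<n}" and ?f = "\<lambda>(i, j). \<bar>A i j\<bar>"
  have sub: "{1..int (m * n)} \<subseteq> ?f ` ?D"
  proof
    fix x assume x: "x \<in> {1..int (m * n)}"
    then obtain i j where "i < m" "j < n" "A i j = x \<or> A i j = - x"
      using A(3) by blast
    moreover from this have "\<bar>A i j\<bar> = x"
      using x by auto
    ultimately show "x \<in> ?f ` ?D" by force
  qed
  have card: "card ?D = card {1..int (m * n)}"
    by (simp add: nat_mult_distrib)
  have le: "card (?f ` ?D) \<le> card {1..int (m * n)}"
    using card_image_le[of ?D ?f] card by simp
  have im: "?f ` ?D = {1..int (m * n)}"
    using card_seteq[OF _ sub le] by simp
  have inj: "inj_on ?f ?D"
    by (rule eq_card_imp_inj_on) (simp_all only: im card finite_lessThan finite_cartesian_product)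
  have range: "A i j \<in> {- int (m * n)..int (m * n)} - {0}" if "i < m" "j < n" for i j
  proof -
    have "\<bar>A i j\<bar> \<in> ?f ` ?D" using that by force
    then show ?thesis unfolding im by (auto simp del: of_nat_mult)
  qed
  show ?thesis
    unfolding integer_heffter_array_def
    by (rule exI[of _ A]) (intro conjI allI impI range A(1)[rule_format] A(2)[rule_format] inj)
qed

text \<open>For a numeral \<open>c\<close> the offsets form a list that \<open>upto.simps\<close>
  unfolds, even if the endpoint is symbolic.\<close>

lemma ball_interval_up: "(\<forall>x\<in>{l..l + c}. P x) \<longleftrightarrow> list_all (\<lambda>i. P (l + i)) [0..c]" for l c :: int
proof -
  have "{l..l + c} = (\<lambda>i. l + i) ` {0..c}" by simp
  then show ?thesis unfolding list_all_iff by (simp del: image_add_atLeastAtMost)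
qed

lemma ball_interval_down: "(\<forall>x\<in>{u - c..u}. P x) \<longleftrightarrow> list_all (\<lambda>i. P (u - i)) [0..c]" for u c :: int
proof -
  have "{u - c..u} = (\<lambda>i. u - i) ` {0..c}" by simp
  then show ?thesis unfolding list_all_iff by (simp del: image_diff_atLeastAtMost)
qed

section \<open>The first three columns\<close>

text \<open>Each class supplies two rows of opposite sign; their column sums are \<open>-2\<close>,
  \<open>1\<close>, \<open>1\<close> for the first pair and \<open>2\<close>, \<open>-1\<close>,
  \<open>-1\<close> for the second. In the induction below \<open>s\<close> is shifted by an odd
  amount, so here the odd offsets go with \<open>r\<close> and the even ones with
  \<open>q\<close>.\<close>

lemma three_cols_block:
  fixes s r q :: int
  shows "covers 4 3 ({s..s + 3} \<union> {r - 1..r} \<union> {q - 1..q} \<union> {s + r + 1..s + r + 1 + 1} \<union> {s + q..s + q + 1})"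
proof (rule covers_lists[where L = "[[s + 1, r, - (s + r + 1)],
        [- (s + 3), - (r - 1), s + r + 2],
        [- s, - q, s + q],
        [s + 2, q - 1, - (s + q + 1)]]"], goal_cases)
  case 4
  show ?case unfolding ball_Un ball_interval_up ball_interval_down
    by (simp add: upto.simps algebra_simps)
qed (simp_all add: upt_rec)

text \<open>
  Rotating the first, second and fifth rows against each other cancels the dominant
  terms \<open>s\<close>, \<open>r\<close>, \<open>- (s + r)\<close> in every column; in the other rows they cancel in pairs of opposite sign.
\<close>
lemma three_cols_core:
  fixes s r q :: int
  shows "covers 9 3 ({s..s + 8} \<union> {r - 4..r} \<union> {q - 3..q} \<union> {s + r..s + r + 4} \<union> {s + q + 1..s + q + 1 + 3})"
proof (rule covers_lists[where L = "[[s, r, - (s + r)],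
        [- (s + r + 1), s + 2, r - 1],
        [- (s + r + 3), s + 6, r - 3],
        [s + r + 4, - (s + 8), - (r - 4)],
        [r - 2, - (s + r + 2), s + 4],
        [q, - (s + q + 1), s + 1],
        [- (q - 1), s + q + 2, - (s + 3)],
        [q - 2, - (s + q + 3), s + 5],
        [- (q - 3), s + q + 4, - (s + 7)]]"], goal_cases)
  case 4
  show ?case unfolding ball_Un ball_interval_up ball_interval_down
    by (simp add: upto.simps algebra_simps)
qed (simp_all add: upt_rec)

lemma three_cols_family:
  fixes s r q :: int
  shows "covers (9 + 4 * k) 3 ({s..s + 8 + 4 * int k} \<union> {r - 4 - 2 * int k..r} \<union> {q - 3 - 2 * int k..q} \<union>
    {s + r..s + r + 4 + 2 * int k} \<union> {s + q + 1..s + q + 4 + 2 * int k})"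
proof (induction k)
  case 0
  show ?case using three_cols_core[of s r q] by (simp add: add.assoc)
next
  case (Suc k)
  let ?s = "s + 9 + 4 * int k" and ?r = "r - 5 - 2 * int k" and ?q = "q - 4 - 2 * int k"
  have eq: "9 + 4 * Suc k = 9 + 4 * k + 4" by simp
  have "{s..s + 8 + 4 * int (Suc k)} \<subseteq> {s..s + 8 + 4 * int k} \<union> {?s..?s + 3}"
    "{r - 4 - 2 * int (Suc k)..r} \<subseteq> {r - 4 - 2 * int k..r} \<union> {?r - 1..?r}"
    "{q - 3 - 2 * int (Suc k)..q} \<subseteq> {q - 3 - 2 * int k..q} \<union> {?q - 1..?q}"
    "{s + r..s + r + 4 + 2 * int (Suc k)} \<subseteq> {s + r..s + r + 4 + 2 * int k} \<union> {?s + ?r + 1..?s + ?r + 1 + 1}"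
    "{s + q + 1..s + q + 4 + 2 * int (Suc k)} \<subseteq> {s + q + 1..s + q + 4 + 2 * int k} \<union> {?s + ?q..?s + ?q + 1}"
    by auto
  then show ?case
    unfolding eq by (intro covers_mono[OF covers_append_rows[OF Suc three_cols_block[of ?s ?r ?q]]]) blast
qed

lemma three_cols:
  fixes s r :: int
  assumes "2 \<le> a"
  shows "covers (4 * a + 1) 3 ({s..s + 4 * int a} \<union> {r - 4 * int a..r} \<union>
    {s + r - 2 * int a..s + r + 2 * int a})"
proof -
  obtain k where k: "a = k + 2"
    using assms by (metis add.commute le_Suc_ex)
  \<comment> \<open>The \<open>q\<close>-values then start right below the \<open>r\<close>-values,
    and the sums with \<open>q\<close> end right below \<open>s + r\<close>, so the pieces merge
    into single intervals.\<close>
  let ?q = "r - 2 * int a - 1"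
  have eq: "4 * a + 1 = 9 + 4 * k" using k by simp
  have "{s..s + 4 * int a} \<subseteq> {s..s + 8 + 4 * int k}"
    "{r - 4 * int a..r} \<subseteq> {r - 4 - 2 * int k..r} \<union> {?q - 3 - 2 * int k..?q}"
    "{s + r - 2 * int a..s + r + 2 * int a} \<subseteq>
      {s + r..s + r + 4 + 2 * int k} \<union> {s + ?q + 1..s + ?q + 4 + 2 * int k}"
    using k by auto
  then show ?thesis
    unfolding eq by (intro covers_mono[OF three_cols_family[of k s r ?q]]) blast
qed

section \<open>The first five entries of the other columns\<close>

text \<open>The differences \<open>z - x - y\<close> in the four columns are 2, 2, 1, 1 for
  \<open>e = 2\<close> and -1, -1, -2, -2 for \<open>e = - 1\<close>. In both cases pairs with
  offsets 0, 1 and 6, 7 and 2, 4 and 3, 5 from \<open>w\<close> make up for them, arranged so that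
  the last two rows also sum to 0.\<close>

lemma five_rows_block:
  fixes s r q w e :: int
  assumes "e = 2 \<or> e = - 1"
  shows "covers 5 4 ({s..s + 3} \<union> {r - 1..r} \<union> {q - 1..q} \<union> {s + r + e..s + r + e + 1} \<union>
    {s + q + e..s + q + e + 1} \<union> {w..w + 7})"
proof -
  have "covers 5 4 ({s..s + 3} \<union> {r - 1..r} \<union> {q - 1..q} \<union> {s + r + 2..s + r + 2 + 1} \<union>
    {s + q + 2..s + q + 2 + 1} \<union> {w..w + 7})"
  proof (rule covers_lists[where L = "[[s, - (s + 2), - (s + 1), s + 3],
      [r, - (r - 1), - q, q - 1],
      [- (s + r + 2), s + r + 3, s + q + 2, - (s + q + 3)],
      [w + 4, w + 3, - (w + 1), - (w + 6)],
      [- (w + 2), - (w + 5), w, w + 7]]"], goal_cases)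
    case 4
    show ?case unfolding ball_Un ball_interval_up ball_interval_down
      by (simp add: upto.simps algebra_simps)
  qed (simp_all add: upt_rec)
  moreover have "covers 5 4 ({s..s + 3} \<union> {r - 1..r} \<union> {q - 1..q} \<union> {s + r + - 1..s + r + - 1 + 1} \<union>
    {s + q + - 1..s + q + - 1 + 1} \<union> {w..w + 7})"
  proof (rule covers_lists[where L = "[[s, - (s + 2), - (s + 1), s + 3],
      [r, - (r - 1), - q, q - 1],
      [- (s + r - 1), s + r, s + q - 1, - (s + q)],
      [w, w + 7, - (w + 2), - (w + 5)],
      [- (w + 1), - (w + 6), w + 4, w + 3]]"], goal_cases)
    case 4
    show ?case unfolding ball_Un ball_interval_up ball_interval_down
      by (simp add: upto.simps algebra_simps)
  qed (simp_all add: upt_rec)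
  ultimately show ?thesis
    using assms by (elim disjE) (simp_all only:)
qed

lemma five_rows_family:
  fixes s r q w e :: int
  assumes "e = 2 \<or> e = - 1"
  shows "covers 5 (4 * k) ({s..<s + 4 * int k} \<union> {r - 2 * int k<..r} \<union> {q - 2 * int k<..q} \<union>
    {s + r + e..<s + r + e + 2 * int k} \<union> {s + q + e..<s + q + e + 2 * int k} \<union> {w..<w + 8 * int k})"
proof (induction k)
  case 0
  show ?case using covers_no_cols by simp
next
  case (Suc k)
  let ?s = "s + 4 * int k" and ?r = "r - 2 * int k" and ?q = "q - 2 * int k" and ?w = "w + 8 * int k"
  have eq: "4 * Suc k = 4 * k + 4" by simp
  have "{s..<s + 4 * int (Suc k)} \<subseteq> {s..<s + 4 * int k} \<union> {?s..?s + 3}"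
    "{r - 2 * int (Suc k)<..r} \<subseteq> {r - 2 * int k<..r} \<union> {?r - 1..?r}"
    "{q - 2 * int (Suc k)<..q} \<subseteq> {q - 2 * int k<..q} \<union> {?q - 1..?q}"
    "{s + r + e..<s + r + e + 2 * int (Suc k)} \<subseteq>
      {s + r + e..<s + r + e + 2 * int k} \<union> {?s + ?r + e..?s + ?r + e + 1}"
    "{s + q + e..<s + q + e + 2 * int (Suc k)} \<subseteq>
      {s + q + e..<s + q + e + 2 * int k} \<union> {?s + ?q + e..?s + ?q + e + 1}"
    "{w..<w + 8 * int (Suc k)} \<subseteq> {w..<w + 8 * int k} \<union> {?w..?w + 7}"
    by auto
  then show ?case
    unfolding eq by (intro covers_mono[OF covers_append_cols[OF Suc five_rows_block[OF assms, of ?s ?r ?q ?w]]]) blast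
qed

lemma five_rows:
  fixes s r w e :: int
  assumes "e = 2 \<or> e = - 1"
  shows "covers 5 (4 * b) ({s..<s + 4 * int b} \<union> {r - 4 * int b<..r} \<union>
    {s + r + e - 2 * int b..<s + r + e + 2 * int b} \<union> {w..<w + 8 * int b})"
proof -
  \<comment> \<open>Again chosen so that the two classes become adjacent.\<close>
  let ?q = "r - 2 * int b"
  have "{r - 4 * int b<..r} \<subseteq> {r - 2 * int b<..r} \<union> {?q - 2 * int b<..?q}"
    "{s + r + e - 2 * int b..<s + r + e + 2 * int b} \<subseteq>
      {s + r + e..<s + r + e + 2 * int b} \<union> {s + ?q + e..<s + ?q + e + 2 * int b}"
    by auto
  then show ?thesis
    by (intro covers_mono[OF five_rows_family[OF assms, of b s r ?q w]]) blast
qed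

text \<open>Found by a computer search.\<close>
lemma five_rows_extreme:
  fixes N :: int
  shows "covers 5 4 ({1..1 + 9} \<union> {N - 9..N})"
proof (rule covers_lists[where L = "[[- (N - 9), N - 4, - 4, - 1],
    [- 8, 9, N - 2, - (N - 1)],
    [N, - 3, - (N - 5), - 2],
    [N - 7, - (N - 8), - 6, 5],
    [- (N - 6), - 10, 7, N - 3]]"], goal_cases)
  case 4
  show ?case unfolding ball_Un ball_interval_up ball_interval_down
    by (simp add: upto.simps algebra_simps)
qed (simp_all add: upt_rec)

section \<open>Tiling by four-by-four arrays on runs of four consecutive integers\<close>

definition quads :: "nat \<Rightarrow> int set \<Rightarrow> bool" where
  "quads N S \<longleftrightarrow> (\<exists>g :: nat \<Rightarrow> int. S \<subseteq> (\<Union>i<N. {g i..g i + 3}))"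

lemma quads_split:
  assumes "quads (M + N) S"
  obtains T U where "S \<subseteq> T \<union> U" "quads M T" "quads N U"
proof -
  obtain g where g: "S \<subseteq> (\<Union>i<M + N. {g i..g i + 3})"
    using assms unfolding quads_def by blast
  let ?h = "\<lambda>i. g (M + i)"
  have "S \<subseteq> (\<Union>i<M. {g i..g i + 3}) \<union> (\<Union>i<N. {?h i..?h i + 3})"
  proof
    fix x assume "x \<in> S"
    then obtain i where i: "i < M + N" "x \<in> {g i..g i + 3}"
      using g by blast
    show "x \<in> (\<Union>i<M. {g i..g i + 3}) \<union> (\<Union>i<N. {?h i..?h i + 3})"
    proof (cases "i < M")
      case False
      then have "x \<in> (\<Union>i<N. {?h i..?h i + 3})"
        using i by (intro UN_I[of "i - M"]) auto
      then show ?thesis ..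
    qed (use i in blast)
  qed
  moreover have "quads M (\<Union>i<M. {g i..g i + 3})"
    unfolding quads_def by (rule exI[of _ g]) simp
  moreover have "quads N (\<Union>i<N. {?h i..?h i + 3})"
    unfolding quads_def by (rule exI[of _ ?h]) simp
  ultimately show thesis by (rule that)
qed

lemma quads_Un:
  assumes "quads M S" "quads N T"
  shows "quads (M + N) (S \<union> T)"
proof -
  obtain g h where g: "S \<subseteq> (\<Union>i<M. {g i..g i + 3})" and h: "T \<subseteq> (\<Union>i<N. {h i..h i + 3})"
    using assms unfolding quads_def by blast
  let ?f = "\<lambda>i. if i < M then g i else h (i - M)"
  have "S \<union> T \<subseteq> (\<Union>i<M + N. {?f i..?f i + 3})"
  proof
    fix x assume "x \<in> S \<union> T"
    then consider i where "i < M" "x \<in> {g i..g i + 3}" | i where "i < N" "x \<in> {h i..h i + 3}"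
      using g h by blast
    then show "x \<in> (\<Union>i<M + N. {?f i..?f i + 3})"
    proof cases
      case 1
      then show ?thesis by (intro UN_I[of i]) auto
    next
      case 2
      then show ?thesis by (intro UN_I[of "M + i"]) auto
    qed
  qed
  then show ?thesis unfolding quads_def by (intro exI[of _ ?f])
qed

lemma quads_interval: "quads k {l..<l + 4 * int k}"
proof -
  have "x \<in> (\<Union>i<k. {l + 4 * int i..l + 4 * int i + 3})" if "x \<in> {l..<l + 4 * int k}" for x
  proof (rule UN_I[of "nat ((x - l) div 4)"])
    have "int (nat ((x - l) div 4)) = (x - l) div 4" using that by simp
    then show "x \<in> {l + 4 * int (nat ((x - l) div 4))..l + 4 * int (nat ((x - l) div 4)) + 3}"
      by simp presburger
    show "nat ((x - l) div 4) \<in> {..<k}"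
      using that by (simp; linarith)
  qed
  then show ?thesis unfolding quads_def by (intro exI[of _ "\<lambda>i. l + 4 * int i"]) blast
qed

text \<open>Each run fills one quadrant, with row sums -1, 1 and column sums -2, 2 up to a common
  sign; adjacent quadrants carry opposite signs.\<close>

lemma covers_four_by_four:
  assumes "quads 4 S"
  shows "covers 4 4 S"
proof -
  obtain g :: "nat \<Rightarrow> int" where g: "S \<subseteq> (\<Union>i<4. {g i..g i + 3})"
    using assms unfolding quads_def by blast
  have "covers 4 4 ({g 0..g 0 + 3} \<union> {g 1..g 1 + 3} \<union> {g 2..g 2 + 3} \<union> {g 3..g 3 + 3})"
  proof (rule covers_lists[where L = "[[g 0, - (g 0 + 1), - g 1, g 1 + 1],
    [- (g 0 + 2), g 0 + 3, g 1 + 2, - (g 1 + 3)],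
    [- g 2, g 2 + 1, g 3, - (g 3 + 1)],
    [g 2 + 2, - (g 2 + 3), - (g 3 + 2), g 3 + 3]]"], goal_cases)
    case 4
    show ?case unfolding ball_Un ball_interval_up ball_interval_down
      by (simp add: upto.simps algebra_simps)
  qed (simp_all add: upt_rec)
  moreover have "(\<Union>i<(4::nat). {g i..g i + 3}) = {g 0..g 0 + 3} \<union> {g 1..g 1 + 3} \<union> {g 2..g 2 + 3} \<union> {g 3..g 3 + 3}"
    by (simp add: lessThan_nat_numeral lessThan_Suc Un_ac)
  ultimately show ?thesis
    using g by (simp add: covers_mono)
qed

lemma covers_four_rows: "quads (4 * b) S \<Longrightarrow> covers 4 (4 * b) S"
proof (induction b arbitrary: S)
  case 0
  then show ?case using covers_no_cols by (simp add: quads_def)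
next
  case (Suc b)
  then have "quads (4 * b + 4) S" by (simp add: add.commute)
  then obtain T U where "S \<subseteq> T \<union> U" "quads (4 * b) T" "quads 4 U"
    by (rule quads_split)
  with covers_append_cols[OF Suc.IH covers_four_by_four] show ?case
    by (metis covers_mono mult_Suc_right add.commute)
qed

lemma covers_of_quads: "quads (4 * a * b) S \<Longrightarrow> covers (4 * a) (4 * b) S"
proof (induction a arbitrary: S)
  case 0
  then show ?case using covers_transpose[OF covers_no_cols] by (simp add: quads_def)
next
  case (Suc a)
  then have "quads (4 * a * b + 4 * b) S" by (simp add: algebra_simps)
  then obtain T U where "S \<subseteq> T \<union> U" "quads (4 * a * b) T" "quads (4 * b) U"
    by (rule quads_split)
  with covers_append_rows[OF Suc.IH covers_four_rows] show ?case
    by (metis covers_mono mult_Suc_right add.commute)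
qed

section \<open>Placing the intervals with gaps divisible by 4\<close>

lemma quads_four_intervals:
  fixes l0 l1 l2 l3 G0 G1 G2 G3 :: int
  assumes "0 \<le> G0" "0 \<le> G1" "0 \<le> G2" "0 \<le> G3"
    and "4 dvd G0" "4 dvd G1" "4 dvd G2" "G0 + G1 + G2 + G3 = 4 * int N"
  shows "quads N ({l0..<l0 + G0} \<union> {l1..<l1 + G1} \<union> {l2..<l2 + G2} \<union> {l3..<l3 + G3})"
proof -
  have "4 dvd G3" using assms(5-8) by presburger
  moreover have "\<exists>k. G = 4 * int k" if "0 \<le> G" "4 dvd G" for G
    using that by (intro exI[of _ "nat (G div 4)"]) (simp add: pos_imp_zdiv_nonneg_iff)
  ultimately obtain k0 k1 k2 k3 where
    G: "G0 = 4 * int k0" "G1 = 4 * int k1" "G2 = 4 * int k2" "G3 = 4 * int k3"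
    using assms(1-7) by meson
  then have N: "N = k0 + k1 + k2 + k3" using assms(8) by linarith
  show ?thesis
    unfolding G N by (intro quads_Un quads_interval)
qed

text \<open>
  Here and below, \<open>z\<close> and \<open>z'\<close> are the left ends of the intervals of sums, the \<open>G\<close>s are the lengths of
  the gaps, and \<open>G0\<close> is chosen so that the other gaps are nonnegative.
\<close>
lemma partition_same_parity:
  fixes a b N :: nat and c :: int
  assumes c: "0 \<le> c" "4 dvd c + 2 * int b" and ab: "even (a + b)"
    and N: "2 * c + 8 * int a + 4 * int b \<le> 4 * int N"
  obtains s r s' r' w Q where "quads N Q"
    "{c + 1..c + 3 * (4 * int a + 1) + 20 * int b + 4 * int N} \<subseteq>
      ({s..s + 4 * int a} \<union> {r - 4 * int a..r} \<union> {s + r - 2 * int a..s + r + 2 * int a}) \<union>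
      ({s'..<s' + 4 * int b} \<union> {r' - 4 * int b<..r'} \<union>
        {s' + r' + - 1 - 2 * int b..<s' + r' + - 1 + 2 * int b} \<union> {w..<w + 8 * int b}) \<union> Q"
proof -
  define G0 where "G0 = 2 * int a + 2 * int b"
  \<comment> \<open>Once \<open>G0\<close> is fixed, \<open>z = s + r - 2 * int a\<close> forces
    \<open>G1 = c + G0 - 2 * int a\<close>, and \<open>z'\<close> likewise forces
    \<open>G2 = c + G0 + 4 * int a - 2 * int b\<close>. As \<open>a + b\<close> is even, 4 divides
    \<open>G0\<close>, and both others are congruent to \<open>c + 2 * int b\<close> modulo
    4.\<close>
  define G1 where "G1 = c + 2 * int b"
  define G2 where "G2 = c + 6 * int a"
  define G3 where "G3 = 4 * int N - G0 - G1 - G2"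
  define s where "s = c + 1 + G0"
  define s' where "s' = s + 4 * int a + 1"
  define r where "r = s' + 4 * int b + 4 * int a"
  define z where "z = r + 1 + G1"
  define r' where "r' = z + 4 * int a + 4 * int b"
  define z' where "z' = r' + 1 + G2"
  define w where "w = z' + 4 * int b"
  define Q where "Q = {c + 1..<c + 1 + G0} \<union> {r + 1..<r + 1 + G1} \<union>
    {r' + 1..<r' + 1 + G2} \<union> {w + 8 * int b..<w + 8 * int b + G3}"
  note defs = G0_def G1_def G2_def G3_def s_def s'_def r_def z_def r'_def z'_def w_def
  have "quads N Q"
    unfolding Q_def
  proof (rule quads_four_intervals)
    show "4 dvd G0" "4 dvd G1" "4 dvd G2" using c ab unfolding defs by presburger+
  qed (use c N in \<open>simp_all add: defs\<close>)
  moreover have "{c + 1..c + 3 * (4 * int a + 1) + 20 * int b + 4 * int N} =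
    {c + 1..<w + 8 * int b + G3}"
    unfolding defs by auto
  moreover have "{c + 1..<w + 8 * int b + G3} \<subseteq> {c + 1..<s} \<union> {s..<s'} \<union> {s'..<s' + 4 * int b} \<union>
    {s' + 4 * int b..<r + 1} \<union> {r + 1..<z} \<union> {z..<z + 4 * int a + 1} \<union> {z + 4 * int a + 1..<r' + 1} \<union>
    {r' + 1..<z'} \<union> {z'..<w} \<union> {w..<w + 8 * int b} \<union> {w + 8 * int b..<w + 8 * int b + G3}"
    by auto
  moreover have "{s..<s'} = {s..s + 4 * int a}" "{s' + 4 * int b..<r + 1} = {r - 4 * int a..r}"
    "{z..<z + 4 * int a + 1} = {s + r - 2 * int a..s + r + 2 * int a}"
    "{z + 4 * int a + 1..<r' + 1} = {r' - 4 * int b<..r'}"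
    "{z'..<w} = {s' + r' + - 1 - 2 * int b..<s' + r' + - 1 + 2 * int b}"
    unfolding defs by auto
  ultimately show thesis
    by (intro that[of Q s r s' r' w]) (auto simp: Q_def s_def z_def z'_def)
qed

text \<open>Compared with the previous layout, the intervals at \<open>s\<close> and
  \<open>s'\<close> swap places. No interval of odd length precedes \<open>s'\<close> any more, so
  the offset \<open>2\<close> replaces \<open>- 1\<close> to keep \<open>G2\<close> even. Now
  \<open>G0 = 2 * int a + 2 * int b - 2\<close> is divisible by 4 because \<open>a + b\<close> is
  odd.\<close>

lemma partition_distinct_parity:
  fixes a b N :: nat and c :: int
  assumes c: "0 \<le> c" "2 \<le> c + 6 * int b" "4 dvd c + 2 * int a" and a: "1 \<le> a" and ab: "odd (a + b)"
    and N: "2 * c + 4 * int a + 8 * int b \<le> 4 * int N + 4"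
  obtains s r s' r' w Q where "quads N Q"
    "{c + 1..c + 3 * (4 * int a + 1) + 20 * int b + 4 * int N} \<subseteq>
      ({s..s + 4 * int a} \<union> {r - 4 * int a..r} \<union> {s + r - 2 * int a..s + r + 2 * int a}) \<union>
      ({s'..<s' + 4 * int b} \<union> {r' - 4 * int b<..r'} \<union>
        {s' + r' + 2 - 2 * int b..<s' + r' + 2 + 2 * int b} \<union> {w..<w + 8 * int b}) \<union> Q"
proof -
  define G0 where "G0 = 2 * int a + 2 * int b - 2"
  define G1 where "G1 = c + 6 * int b - 2"
  define G2 where "G2 = c + 2 * int a"
  define G3 where "G3 = 4 * int N - G0 - G1 - G2"
  define s' where "s' = c + 1 + G0"
  define s where "s = s' + 4 * int b"
  define r where "r = s + 4 * int a + 1 + 4 * int a"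
  define z where "z = r + 1 + G1"
  define r' where "r' = z + 4 * int a + 4 * int b"
  define z' where "z' = r' + 1 + G2"
  define w where "w = z' + 4 * int b"
  define Q where "Q = {c + 1..<c + 1 + G0} \<union> {r + 1..<r + 1 + G1} \<union>
    {r' + 1..<r' + 1 + G2} \<union> {w + 8 * int b..<w + 8 * int b + G3}"
  note defs = G0_def G1_def G2_def G3_def s_def s'_def r_def z_def r'_def z'_def w_def
  have "quads N Q"
    unfolding Q_def
  proof (rule quads_four_intervals)
    show "4 dvd G0" "4 dvd G1" "4 dvd G2" using c ab unfolding defs by presburger+
  qed (use c N a in \<open>simp_all add: defs\<close>)
  moreover have "{c + 1..c + 3 * (4 * int a + 1) + 20 * int b + 4 * int N} =
    {c + 1..<w + 8 * int b + G3}"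
    unfolding defs by auto
  moreover have "{c + 1..<w + 8 * int b + G3} \<subseteq> {c + 1..<s'} \<union> {s'..<s} \<union> {s..<s + 4 * int a + 1} \<union>
    {s + 4 * int a + 1..<r + 1} \<union> {r + 1..<z} \<union> {z..<z + 4 * int a + 1} \<union> {z + 4 * int a + 1..<r' + 1} \<union>
    {r' + 1..<z'} \<union> {z'..<w} \<union> {w..<w + 8 * int b} \<union> {w + 8 * int b..<w + 8 * int b + G3}"
    by auto
  moreover have "{s'..<s} = {s'..<s' + 4 * int b}" "{s..<s + 4 * int a + 1} = {s..s + 4 * int a}"
    "{s + 4 * int a + 1..<r + 1} = {r - 4 * int a..r}"
    "{z..<z + 4 * int a + 1} = {s + r - 2 * int a..s + r + 2 * int a}"
    "{z + 4 * int a + 1..<r' + 1} = {r' - 4 * int b<..r'}"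
    "{z'..<w} = {s' + r' + 2 - 2 * int b..<s' + r' + 2 + 2 * int b}"
    unfolding defs by auto
  ultimately show thesis
    by (intro that[of Q s r s' r' w]) (auto simp: Q_def s'_def z_def z'_def)
qed

section \<open>Case distinction and assembly of the array\<close>

text \<open>In both cases 4 divides \<open>c + 2 * int a\<close>, which is what either partition
  needs; this is why \<open>c\<close> is 10 for odd \<open>a\<close>.\<close>

lemma interval_covers:
  fixes a b k :: nat and c :: int
  assumes a: "2 \<le> a" and k: "1 \<le> k" and bc: "even a \<and> c = 0 \<and> b = k \<or> odd a \<and> c = 10 \<and> b + 1 = k"
  obtains S T Q where "covers (4 * a + 1) 3 S" "covers 5 (4 * b) T" "covers (4 * (a - 1)) (4 * k) Q"
    "{c + 1..c + 3 * (4 * int a + 1) + 20 * int b + 16 * (int a - 1) * int k} \<subseteq> S \<union> T \<union> Q"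
proof -
  let ?N = "4 * (a - 1) * k"
  have N: "4 * int ?N = 16 * (int a - 1) * int k"
    using a by (simp add: of_nat_diff)
  \<comment> \<open>Such products bound \<open>a * k\<close> below by a linear term, which makes the
    size bounds linear.\<close>
  have p21: "0 \<le> (int a - 2) * (int k - 1)"
    using a k by simp
  obtain s r s' r' w e Q where e: "e = 2 \<or> e = - 1" and Q: "quads ?N Q" and
    sub: "{c + 1..c + 3 * (4 * int a + 1) + 20 * int b + 4 * int ?N} \<subseteq>
      ({s..s + 4 * int a} \<union> {r - 4 * int a..r} \<union> {s + r - 2 * int a..s + r + 2 * int a}) \<union>
      ({s'..<s' + 4 * int b} \<union> {r' - 4 * int b<..r'} \<union>
        {s' + r' + e - 2 * int b..<s' + r' + e + 2 * int b} \<union> {w..<w + 8 * int b}) \<union> Q"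
  proof (cases "even (a + b)")
    case True
    \<comment> \<open>Equal parity excludes \<open>k = 1\<close>: either \<open>k\<close> is even,
      or \<open>k - 1\<close> is odd. For \<open>a = 2\<close> and \<open>k = 1\<close> the bound
      below would fail.\<close>
    have k2: "2 \<le> k" using True bc k by presburger
    then have p22: "0 \<le> (int a - 2) * (int k - 2)" using a by simp
    have bound: "2 * c + 8 * int a + 4 * int b \<le> 4 * int ?N"
      using bc
    proof
      assume "even a \<and> c = 0 \<and> b = k"
      then show ?thesis unfolding N using a k2 p22 by (simp add: algebra_simps)
    next
      assume odd: "odd a \<and> c = 10 \<and> b + 1 = k"
      then have "3 \<le> a" using a by presburger
      moreover have "int k = int b + 1" using odd by simp
      ultimately show ?thesis unfolding N using odd k2 p22 by (simp add: algebra_simps)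
    qed
    have c: "0 \<le> c" "4 dvd c + 2 * int b" using bc True by presburger+
    show thesis
      by (rule partition_same_parity[OF c True bound]) (rule that[where e = "- 1"], simp, assumption+)
  next
    case False
    have bound: "2 * c + 4 * int a + 8 * int b \<le> 4 * int ?N + 4"
      using bc
    proof
      assume "even a \<and> c = 0 \<and> b = k"
      then show ?thesis unfolding N using a k p21 by (simp add: algebra_simps)
    next
      assume odd: "odd a \<and> c = 10 \<and> b + 1 = k"
      then have "3 \<le> a" using a by presburger
      moreover have "0 \<le> (int a - 3) * int b" using \<open>3 \<le> a\<close> by simp
      moreover have "k = Suc b" "c = 10" using odd by simp_all
      ultimately show ?thesis unfolding N by (simp add: algebra_simps)
    qed
    have c: "0 \<le> c" "2 \<le> c + 6 * int b" "4 dvd c + 2 * int a" "1 \<le> a"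
      using bc a k False by presburger+
    show thesis
      by (rule partition_distinct_parity[OF c False bound]) (rule that[where e = 2], simp, assumption+)
  qed
  show thesis
    by (rule that[OF three_cols[OF a, of s r] five_rows[OF e, of b s' r' w] covers_of_quads[OF Q]])
      (use sub in \<open>unfold N\<close>)
qed

theorem theorem12:
  fixes m n :: nat
  assumes "m \<ge> 9" and "m mod 4 = 1" and "n \<ge> 7" and "n mod 4 = 3"
  shows "\<exists>A. integer_heffter_array m n A"
proof -
  define a k where "a = m div 4" and "k = n div 4"
  have m: "m = 4 * a + 1" and n: "n = 3 + 4 * k" and a: "2 \<le> a" and k: "1 \<le> k"
    using assms unfolding a_def k_def by presburger+
  have mn: "int (m * n) = (4 * int a + 1) * (3 + 4 * int k)"
    by (simp add: m n algebra_simps)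
  have m': "m = 5 + 4 * (a - 1)" using m a by simp
  have "covers m (3 + 4 * k) {1..int (m * n)}"
  proof (cases "even a")
    case True
    then have bc: "even a \<and> (0::int) = 0 \<and> k = k \<or> odd a \<and> (0::int) = 10 \<and> k + 1 = k" by simp
    obtain S T Q where S: "covers (4 * a + 1) 3 S" and T: "covers 5 (4 * k) T"
      and Q: "covers (4 * (a - 1)) (4 * k) Q"
      and sub: "{0 + 1..0 + 3 * (4 * int a + 1) + 20 * int k + 16 * (int a - 1) * int k} \<subseteq> S \<union> T \<union> Q"
      by (rule interval_covers[OF a k bc])
    have "covers m (4 * k) (T \<union> Q)"
      unfolding m' by (rule covers_append_rows[OF T Q])
    moreover have "0 + 3 * (4 * int a + 1) + 20 * int k + 16 * (int a - 1) * int k = int (m * n)"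
      unfolding mn by (simp add: algebra_simps)
    then have "{1..int (m * n)} \<subseteq> S \<union> (T \<union> Q)"
      using sub by (simp only: Un_assoc add_0)
    ultimately show ?thesis
      using covers_mono[OF covers_append_cols[OF S[folded m]]] by blast
  next
    case False
    \<comment> \<open>One group of four columns in the five-row strip is reserved for the block with
      the ten smallest and ten largest values.\<close>
    obtain b where b: "k = b + 1" using k by (metis add.commute le_Suc_ex)
    with False have bc: "even a \<and> (10::int) = 0 \<and> b = k \<or> odd a \<and> (10::int) = 10 \<and> b + 1 = k" by simp
    obtain S T Q where S: "covers (4 * a + 1) 3 S" and T: "covers 5 (4 * b) T"
      and Q: "covers (4 * (a - 1)) (4 * k) Q"
      and sub: "{10 + 1..10 + 3 * (4 * int a + 1) + 20 * int b + 16 * (int a - 1) * int k} \<subseteq> S \<union> T \<union> Q"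
      by (rule interval_covers[OF a k bc])
    let ?M = "int (m * n)"
    let ?E = "{1..1 + 9} \<union> {?M - 9..?M}"
    have b4: "4 * k = 4 * b + 4" using b by simp
    have "covers m (4 * k) (T \<union> ?E \<union> Q)"
      unfolding m'
      by (rule covers_append_rows[OF _ Q]) (unfold b4, rule covers_append_cols[OF T five_rows_extreme])
    moreover have "10 + 3 * (4 * int a + 1) + 20 * int b + 16 * (int a - 1) * int k = ?M - 10"
      unfolding mn b by (simp add: algebra_simps)
    then have "{10 + 1..?M - 10} \<subseteq> S \<union> T \<union> Q"
      using sub by (simp only:)
    moreover have "{1..?M} \<subseteq> ?E \<union> {10 + 1..?M - 10}"
      by auto
    ultimately show ?thesis
      by (intro covers_mono[OF covers_append_cols[OF S[folded m]]]) blast+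
  qed
  then show ?thesis
    unfolding n[symmetric] by (rule integer_heffter_array_of_covers)
qed
end
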